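(* A proper set system is a vf-safe delta-matroid if and only if it has no $3$-minor that is isomorphic to a twisted dual of $S_3=(\{e_1,e_2,e_3\},\{\emptyset,\{e_1,e_2,e_3\}\})$.
   Context: A set system is a pair $S=(E,\mathcal F)$ where $E$ is a finite set and $\mathcal F$ is a collection of subsets of $E$ (the feasible sets); $S$ is proper if $\mathcal F\neq\emptyset$. Two set systems are isomorphic if some bijection between their ground sets maps the feasible sets of one onto the feasible sets of the other. A delta-matroid is a proper set system such that for all $X,Y\in\mathcal F$ and all $u\in X\triangle Y$ there is $v\in X\triangle Y$ (possibly $v=u$) with $X\triangle\{u,v\}\in\mathcal F$. For $e\in E$: $e$ is a loop if it lies in no feasible set, and a coloop if it lies in every feasible set. If $e$ is not a loop, the contraction is $S/e=(E-e,\{F-e: e\in F\in\mathcal F\})$; if $e$ is not a coloop, the deletion is $S\setminus e=(E-e,\{F\in\mathcal F: e\notin F\})$; if $e$ is a loop or a coloop, whichever of $S/e$, $S\setminus e$ is undefined is set equal to the other. For $A\subseteq E$, the twist is $S*A=(E,\{F\triangle A: F\in\mathcal F\})$, and the loop complementation $S+A$ is the set system on $E$ in which $F\subseteq E$ is feasible if and only if $S$ has an odd number of feasible sets $F'$ with $F-A\subseteq F'\subseteq F$ (write $S+e$ for $S+\{e\}$). A twisted dual of $S$ is any set system obtained from $S$ by a finite sequence of twists and loop complementations. The Penrose contraction of $e$ is $S\ddagger e=(S+e)/e$. A $3$-minor of $S$ is any set system obtained from $S$ by a finite (possibly empty) sequence of single-element deletions, contractions and Penrose contractions. A delta-matroid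 is vf-safe if all of its twisted duals are delta-matroids. *)

theory Defs
  imports Main
begin

type_synonym 'a set_system = "'a set \<times> 'a set set"

abbreviation ground :: "'a set_system \<Rightarrow> 'a set" where
  "ground S \<equiv> fst S"

abbreviation feasible :: "'a set_system \<Rightarrow> 'a set set" where
  "feasible S \<equiv> snd S"

definition set_system :: "'a set_system \<Rightarrow> bool" where
  "set_system S \<longleftrightarrow> finite (ground S) \<and> feasible S \<subseteq> Pow (ground S)"

definition proper :: "'a set_system \<Rightarrow> bool" where
  "proper S \<longleftrightarrow> feasible S \<noteq> {}"

definition isomorphic :: "'a set_system \<Rightarrow> 'b set_system \<Rightarrow> bool" where
  "isomorphic S T \<longleftrightarrow>
     (\<exists>f. bij_betw f (ground S) (ground T) \<and> (\<lambda>F. f ` F) ` feasible S = feasible T)"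

definition delta_matroid :: "'a set_system \<Rightarrow> bool" where
  "delta_matroid S \<longleftrightarrow> set_system S \<and> proper S \<and>
     (\<forall>X \<in> feasible S. \<forall>Y \<in> feasible S. \<forall>u \<in> sym_diff X Y.
        \<exists>v \<in> sym_diff X Y. sym_diff X {u, v} \<in> feasible S)"

definition is_loop :: "'a set_system \<Rightarrow> 'a \<Rightarrow> bool" where
  "is_loop S e \<longleftrightarrow> e \<in> ground S \<and> (\<forall>F \<in> feasible S. e \<notin> F)"

definition is_coloop :: "'a set_system \<Rightarrow> 'a \<Rightarrow> bool" where
  "is_coloop S e \<longleftrightarrow> e \<in> ground S \<and> (\<forall>F \<in> feasible S. e \<in> F)"

text \<open>
  The first branch of \<open>contraction\<close> is the deletion of a loop, and the first branch of
  \<open>deletion\<close> is the contraction of a coloop.  In a proper set system no element is both a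
  loop and a coloop; in an improper one all branches give the empty family.
\<close>

definition contraction :: "'a set_system \<Rightarrow> 'a \<Rightarrow> 'a set_system" where
  "contraction S e =
     (if is_loop S e then (ground S - {e}, {F \<in> feasible S. e \<notin> F})
      else (ground S - {e}, {F - {e} | F. F \<in> feasible S \<and> e \<in> F}))"

definition deletion :: "'a set_system \<Rightarrow> 'a \<Rightarrow> 'a set_system" where
  "deletion S e =
     (if is_coloop S e then (ground S - {e}, {F - {e} | F. F \<in> feasible S \<and> e \<in> F})
      else (ground S - {e}, {F \<in> feasible S. e \<notin> F}))"

definition twist :: "'a set_system \<Rightarrow> 'a set \<Rightarrow> 'a set_system" where
  "twist S A = (ground S, {sym_diff F A | F. F \<in> feasible S})"

definition loop_complementation :: "'a set_system \<Rightarrow> 'a set \<Rightarrow> 'a set_system" where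
  "loop_complementation S A =
     (ground S,
      {F. F \<subseteq> ground S \<and> odd (card {F' \<in> feasible S. F - A \<subseteq> F' \<and> F' \<subseteq> F})})"

definition penrose_contraction :: "'a set_system \<Rightarrow> 'a \<Rightarrow> 'a set_system" where
  "penrose_contraction S e = contraction (loop_complementation S {e}) e"

inductive twisted_dual :: "'a set_system \<Rightarrow> 'a set_system \<Rightarrow> bool" for S where
  refl: "twisted_dual S S"
| twist: "twisted_dual S T \<Longrightarrow> A \<subseteq> ground T \<Longrightarrow> twisted_dual S (twist T A)"
| loop_complementation:
    "twisted_dual S T \<Longrightarrow> A \<subseteq> ground T \<Longrightarrow> twisted_dual S (loop_complementation T A)"

inductive three_minor :: "'a set_system \<Rightarrow> 'a set_system \<Rightarrow> bool" for S where
  refl: "three_minor S S"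
| deletion: "three_minor S T \<Longrightarrow> e \<in> ground T \<Longrightarrow> three_minor S (deletion T e)"
| contraction: "three_minor S T \<Longrightarrow> e \<in> ground T \<Longrightarrow> three_minor S (contraction T e)"
| penrose_contraction:
    "three_minor S T \<Longrightarrow> e \<in> ground T \<Longrightarrow> three_minor S (penrose_contraction T e)"

definition vf_safe_delta_matroid :: "'a set_system \<Rightarrow> bool" where
  "vf_safe_delta_matroid S \<longleftrightarrow>
     delta_matroid S \<and> (\<forall>T. twisted_dual S T \<longrightarrow> delta_matroid T)"

definition S3 :: "nat set_system" where
  "S3 = ({1, 2, 3}, {{}, {1, 2, 3}})"

end

theory Submission
  imports Defs
begin

text \<open>
  Twist and loop complementation at \<open>e\<close> permute the three one-element \<open>3\<close>-minors at \<open>e\<close>, and at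
  another element they commute with taking these minors. Hence vf-safety passes to \<open>3\<close>-minors, and
  a minimal system that is not vf-safe may be replaced by a twisted dual in which exchange fails
  for \<open>{}\<close>, a feasible set \<open>Y\<close> and \<open>u \<in> Y\<close>. Deleting an element outside \<open>Y\<close> keeps the failure,
  so by minimality \<open>Y\<close> is the ground set, and likewise \<open>Y\<close> is the only feasible set
  containing \<open>u\<close>. With at least four elements, the failure survives contraction of any \<open>e \<noteq> u\<close> if
  \<open>{e}\<close> is feasible and Penrose contraction otherwise. With three elements \<open>u, a, b\<close>, loop
  complementations at \<open>a\<close> and \<open>b\<close> and its dual at \<open>u\<close> remove \<open>{a}\<close>, \<open>{b}\<close>, \<open>{a, b}\<close>
  and leave a copy of \<open>S3\<close>.
\<close>

section \<open>Twisted duals by single elements\<close>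

lemma set_system_feasible_subset: "set_system S \<Longrightarrow> F \<in> feasible S \<Longrightarrow> F \<subseteq> ground S"
  unfolding set_system_def by blast

lemma ground_twist [simp]: "ground (twist S A) = ground S"
  by (simp add: twist_def)

lemma ground_loop_complementation [simp]: "ground (loop_complementation S A) = ground S"
  by (simp add: loop_complementation_def)

lemma feasible_twist: "F \<in> feasible (twist S A) \<longleftrightarrow> sym_diff F A \<in> feasible S"
proof -
  have inv: "sym_diff (sym_diff G A) A = G" for G by blast
  have "F = sym_diff G A \<longleftrightarrow> G = sym_diff F A" for G
    by (metis inv)
  then show ?thesis by (simp add: twist_def)
qed

text \<open>The sets between \<open>F - {x}\<close> and \<open>F\<close> are just these two, so the
  parity count is the exclusive or of their memberships, written here as
  \<open>\<noteq>\<close>.\<close>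

lemma feasible_loop_complementation_singleton:
  assumes "set_system S"
  shows "F \<in> feasible (loop_complementation S {x}) \<longleftrightarrow>
    F \<subseteq> ground S \<and> (F \<in> feasible S) \<noteq> (x \<in> F \<and> F - {x} \<in> feasible S)"
proof -
  have eq: "{F' \<in> feasible S. F - {x} \<subseteq> F' \<and> F' \<subseteq> F} = feasible S \<inter> {F, F - {x}}" by blast
  have "odd (card (feasible S \<inter> {F, F - {x}})) \<longleftrightarrow>
      (F \<in> feasible S) \<noteq> (x \<in> F \<and> F - {x} \<in> feasible S)"
  proof (cases "x \<in> F")
    case True
    then have "F \<noteq> F - {x}" by blast
    then show ?thesis using True by (auto simp: Int_insert_right card_insert_if)
  next
    case False
    then show ?thesis by (auto simp: Int_insert_right)
  qed
  then show ?thesis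
    by (simp only: loop_complementation_def snd_conv mem_Collect_eq eq simp_thms)
qed

lemma set_system_twist: "set_system S \<Longrightarrow> A \<subseteq> ground S \<Longrightarrow> set_system (twist S A)"
  unfolding set_system_def twist_def by auto

lemma set_system_loop_complementation: "set_system S \<Longrightarrow> set_system (loop_complementation S A)"
  unfolding set_system_def loop_complementation_def by auto

lemma set_system_eqI:
  assumes "ground S = ground T" "\<And>F. F \<in> feasible S \<longleftrightarrow> F \<in> feasible T"
  shows "S = T"
  using assms by (auto simp: prod_eq_iff)

lemma twist_insert:
  assumes "x \<notin> A"
  shows "twist S (insert x A) = twist (twist S A) {x}"
proof (rule set_system_eqI)
  fix F
  have "sym_diff F (insert x A) = sym_diff (sym_diff F {x}) A" using assms by blast
  then show "F \<in> feasible (twist S (insert x A)) \<longleftrightarrow> F \<in> feasible (twist (twist S A) {x})"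
    by (simp add: feasible_twist)
qed simp

text \<open>For \<open>x \<in> F\<close>, the interval counted for \<open>insert x A\<close> splits
  into its members with \<open>x\<close> and its members without \<open>x\<close>. These are the
  intervals for \<open>A\<close> below \<open>F\<close> and below \<open>F - {x}\<close>, so
  parities add as in a loop complementation at \<open>x\<close>.\<close>

lemma loop_complementation_insert:
  assumes S: "set_system S" and x: "x \<notin> A"
  shows "loop_complementation S (insert x A) =
    loop_complementation (loop_complementation S A) {x}"
proof (rule set_system_eqI)
  fix F
  define P where "P A F = {F' \<in> feasible S. F - A \<subseteq> F' \<and> F' \<subseteq> F}" for A F
  have fin: "finite (P A F)" for A F
  proof (rule finite_subset)
    show "P A F \<subseteq> Pow (ground S)"
      using set_system_feasible_subset[OF S] by (auto simp: P_def)
    show "finite (Pow (ground S))" using S by (simp add: set_system_def)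
  qed
  have lc: "F \<in> feasible (loop_complementation S A) \<longleftrightarrow> F \<subseteq> ground S \<and> odd (card (P A F))" for A F
    by (simp add: loop_complementation_def P_def)
  show "F \<in> feasible (loop_complementation S (insert x A)) \<longleftrightarrow>
      F \<in> feasible (loop_complementation (loop_complementation S A) {x})"
  proof (cases "x \<in> F")
    case True
    have "P (insert x A) F = P A F \<union> P A (F - {x})" "P A F \<inter> P A (F - {x}) = {}"
      using True x unfolding P_def by blast+
    then have "card (P (insert x A) F) = card (P A F) + card (P A (F - {x}))"
      by (simp add: card_Un_disjoint fin)
    then show ?thesis using True
      by (auto simp: lc feasible_loop_complementation_singleton set_system_loop_complementation S)
  next
    case False
    then have "P (insert x A) F = P A F" unfolding P_def by blast
    then show ?thesis using False
      by (auto simp: lc feasible_loop_complementation_singleton set_system_loop_complementation S)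
  qed
qed simp

lemma loop_complementation_empty: "set_system S \<Longrightarrow> loop_complementation S {} = S"
proof (rule set_system_eqI)
  fix F assume S: "set_system S"
  have "{F' \<in> feasible S. F - {} \<subseteq> F' \<and> F' \<subseteq> F} = (if F \<in> feasible S then {F} else {})" by auto
  then show "F \<in> feasible (loop_complementation S {}) \<longleftrightarrow> F \<in> feasible S"
    using S set_system_feasible_subset[OF S] by (auto simp: loop_complementation_def)
qed simp

text \<open>Single-element generators. Ground sets are finite, so twists and loop complementations
  by \<open>A\<close> are chains of such steps, and closure properties need checking at one element
  only.\<close>

inductive dual_step :: "'a set_system \<Rightarrow> 'a set_system \<Rightarrow> bool" for S where
  twist: "x \<in> ground S \<Longrightarrow> dual_step S (twist S {x})"
| loop_complementation: "x \<in> ground S \<Longrightarrow> dual_step S (loop_complementation S {x})"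

lemma dual_step_set_system: "dual_step S T \<Longrightarrow> set_system S \<Longrightarrow> set_system T"
  by (induction rule: dual_step.induct)
    (auto intro: set_system_twist set_system_loop_complementation)

lemma dual_steps_set_system: "dual_step\<^sup>*\<^sup>* S T \<Longrightarrow> set_system S \<Longrightarrow> set_system T"
  by (induction rule: rtranclp_induct) (auto intro: dual_step_set_system)

lemma dual_step_ground: "dual_step S T \<Longrightarrow> ground T = ground S"
  by (erule dual_step.cases) simp_all

lemma dual_steps_ground: "dual_step\<^sup>*\<^sup>* S T \<Longrightarrow> ground T = ground S"
  by (induction rule: rtranclp_induct) (simp_all add: dual_step_ground)

lemma dual_steps_twist:
  assumes "finite A" "A \<subseteq> ground S"
  shows "dual_step\<^sup>*\<^sup>* S (twist S A)"
  using assms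
proof (induction A rule: finite_induct)
  case empty
  have "twist S {} = S" by (rule set_system_eqI) (simp_all add: feasible_twist)
  then show ?case by simp
next
  case (insert x A)
  then have "dual_step (twist S A) (twist S (insert x A))"
    using dual_step.twist[of x "twist S A"] twist_insert[of x A S] by simp
  then show ?case using insert by (meson insert_subset rtranclp.rtrancl_into_rtrancl)
qed

lemma dual_steps_loop_complementation:
  assumes "set_system S" "finite A" "A \<subseteq> ground S"
  shows "dual_step\<^sup>*\<^sup>* S (loop_complementation S A)"
  using assms(2,3)
proof (induction A rule: finite_induct)
  case empty
  then show ?case by (simp add: loop_complementation_empty assms(1))
next
  case (insert x A)
  then have "dual_step (loop_complementation S A) (loop_complementation S (insert x A))"
    using dual_step.loop_complementation[of x "loop_complementation S A"]
      loop_complementation_insert[OF assms(1), of x A] by simp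
  then show ?case using insert by (meson insert_subset rtranclp.rtrancl_into_rtrancl)
qed

lemma twisted_dual_iff_dual_steps:
  assumes S: "set_system S"
  shows "twisted_dual S T \<longleftrightarrow> dual_step\<^sup>*\<^sup>* S T"
proof
  assume "twisted_dual S T"
  then show "dual_step\<^sup>*\<^sup>* S T"
  proof (induction rule: twisted_dual.induct)
    case (twist T A)
    have "finite A"
      using twist dual_steps_set_system[OF _ S] by (meson finite_subset set_system_def)
    then show ?case using twist dual_steps_twist by (meson rtranclp_trans)
  next
    case (loop_complementation T A)
    have T: "set_system T" using loop_complementation dual_steps_set_system[OF _ S] by blast
    then have "finite A"
      using loop_complementation by (meson finite_subset set_system_def)
    then show ?case
      using loop_complementation dual_steps_loop_complementation T by (meson rtranclp_trans)
  qed simp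
next
  assume "dual_step\<^sup>*\<^sup>* S T"
  then show "twisted_dual S T"
  proof (induction rule: rtranclp_induct)
    case base
    then show ?case by (rule twisted_dual.refl)
  next
    case (step T U)
    from step(2,3) show ?case
      by (auto elim!: dual_step.cases
          intro: twisted_dual.twist twisted_dual.loop_complementation)
  qed
qed

section \<open>Reversibility of dual steps and preservation of properness\<close>

lemma twist_twist: "twist (twist S A) A = S"
proof (rule set_system_eqI)
  fix F
  have "sym_diff (sym_diff F A) A = F" by blast
  then show "F \<in> feasible (twist (twist S A) A) \<longleftrightarrow> F \<in> feasible S"
    by (simp add: feasible_twist)
qed simp

lemma loop_complementation_singleton_twice:
  assumes S: "set_system S"
  shows "loop_complementation (loop_complementation S {x}) {x} = S"
proof (rule set_system_eqI)
  fix F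
  show "F \<in> feasible (loop_complementation (loop_complementation S {x}) {x}) \<longleftrightarrow> F \<in> feasible S"
    using set_system_feasible_subset[OF S, of F]
    by (cases "F \<subseteq> ground S")
      (auto simp: feasible_loop_complementation_singleton set_system_loop_complementation S)
qed simp

lemma dual_step_sym:
  assumes "set_system S" "dual_step S T"
  shows "dual_step T S"
  using assms(2)
proof cases
  case (twist x)
  then show ?thesis using dual_step.twist[of x T] by (simp add: twist_twist)
next
  case (loop_complementation x)
  then show ?thesis using dual_step.loop_complementation[of x T]
    by (simp add: loop_complementation_singleton_twice assms(1))
qed

lemma dual_steps_sym:
  assumes "set_system S" "dual_step\<^sup>*\<^sup>* S T"
  shows "dual_step\<^sup>*\<^sup>* T S"
  using assms(2)
proof (induction rule: rtranclp_induct)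
  case (step T U)
  then have "dual_step U T"
    using dual_step_sym dual_steps_set_system assms(1) by blast
  then show ?case using step by (meson converse_rtranclp_into_rtranclp)
qed simp

lemma dual_step_proper:
  assumes S: "set_system S" and "dual_step S T" "proper S"
  shows "proper T"
proof -
  obtain F where F: "F \<in> feasible S" using assms(3) by (auto simp: proper_def)
  from assms(2) show ?thesis
  proof cases
    case (twist x)
    then show ?thesis using F unfolding proper_def twist_def by auto
  next
    case (loop_complementation x)
    show ?thesis
    proof (rule ccontr)
      assume "\<not> proper T"
      then have "\<And>G. G \<notin> feasible (loop_complementation S {x})"
        using loop_complementation by (auto simp: proper_def)
      \<comment> \<open>If \<open>F - {x}\<close> is infeasible after the complementation, it is
        infeasible in \<open>S\<close>, so nothing cancels \<open>F\<close>.\<close>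
      from this[of F] this[of "F - {x}"] show False
        using F set_system_feasible_subset[OF S F]
        by (auto simp: feasible_loop_complementation_singleton S)
    qed
  qed
qed

lemma dual_steps_proper:
  assumes "set_system S" "dual_step\<^sup>*\<^sup>* S T" "proper S"
  shows "proper T"
  using assms(2)
  by (induction rule: rtranclp_induct)
    (auto simp: assms intro: dual_step_proper dual_steps_set_system[OF _ assms(1)])

definition vf_safe :: "'a set_system \<Rightarrow> bool" where
  "vf_safe S \<longleftrightarrow> (\<forall>T. dual_step\<^sup>*\<^sup>* S T \<longrightarrow> delta_matroid T)"

lemma vf_safe_delta_matroid_iff: "set_system S \<Longrightarrow> vf_safe_delta_matroid S \<longleftrightarrow> vf_safe S"
  unfolding vf_safe_delta_matroid_def vf_safe_def
  using twisted_dual_iff_dual_steps twisted_dual.refl by blast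

lemma vf_safe_dual_steps: "vf_safe S \<Longrightarrow> dual_step\<^sup>*\<^sup>* S T \<Longrightarrow> vf_safe T"
  unfolding vf_safe_def by (meson rtranclp_trans)

section \<open>Slices\<close>

text \<open>
  Viewing the indicator function of the feasible sets as a tensor over \<open>GF(2)\<close> with one
  two-dimensional factor per element, the slices at \<open>e\<close> are its images under the three nonzero
  functionals on the factor of \<open>e\<close>. Twist and loop complementation at \<open>e\<close> generate
  \<open>GL(2,2)\<close>, which permutes these functionals.
\<close>

definition del_slice :: "'a set_system \<Rightarrow> 'a \<Rightarrow> 'a set_system" where
  "del_slice S e = (ground S - {e}, {F. e \<notin> F \<and> F \<in> feasible S})"

definition con_slice :: "'a set_system \<Rightarrow> 'a \<Rightarrow> 'a set_system" where
  "con_slice S e = (ground S - {e}, {F. e \<notin> F \<and> insert e F \<in> feasible S})"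

definition pen_slice :: "'a set_system \<Rightarrow> 'a \<Rightarrow> 'a set_system" where
  "pen_slice S e =
     (ground S - {e}, {F. e \<notin> F \<and> (F \<in> feasible S) \<noteq> (insert e F \<in> feasible S)})"

definition slices :: "'a set_system \<Rightarrow> 'a \<Rightarrow> 'a set_system set" where
  "slices S e = {del_slice S e, con_slice S e, pen_slice S e}"

text \<open>Properness matches the conventions for loops and coloops, under which an improper slice
  is replaced by another one.\<close>

definition minor_step :: "'a set_system \<Rightarrow> 'a set_system \<Rightarrow> bool" where
  "minor_step S M \<longleftrightarrow> (\<exists>e \<in> ground S. M \<in> slices S e \<and> proper M)"

lemma slices_set_system: "set_system S \<Longrightarrow> M \<in> slices S e \<Longrightarrow> set_system M"
proof -
  assume S: "set_system S" and M: "M \<in> slices S e"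
  have "F \<subseteq> ground S - {e}"
    if "e \<notin> F" "F \<in> feasible S \<or> insert e F \<in> feasible S" for F
    using that set_system_feasible_subset[OF S, of F] set_system_feasible_subset[OF S, of "insert e F"]
    by blast
  moreover have "e \<notin> F \<and> (F \<in> feasible S \<or> insert e F \<in> feasible S)" if "F \<in> feasible M" for F
    using that M unfolding slices_def del_slice_def con_slice_def pen_slice_def by auto
  moreover have "ground M = ground S - {e}"
    using M unfolding slices_def del_slice_def con_slice_def pen_slice_def by auto
  ultimately show "set_system M"
    using S unfolding set_system_def by (metis PowI finite_Diff subsetI)
qed

lemma ground_slices: "M \<in> slices S e \<Longrightarrow> ground M = ground S - {e}"
  unfolding slices_def del_slice_def con_slice_def pen_slice_def by auto

section \<open>Action of twists and loop complementations on slices\<close>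

lemma con_slice_eq_del_slice: "con_slice S e = del_slice (twist S {e}) e"
proof -
  have "e \<notin> F \<Longrightarrow> sym_diff F {e} = insert e F" for F by auto
  then show ?thesis unfolding con_slice_def del_slice_def by (auto simp: feasible_twist)
qed

lemma del_slice_twist: "del_slice (twist S {e}) e = con_slice S e"
  by (simp add: con_slice_eq_del_slice)

lemma con_slice_twist: "con_slice (twist S {e}) e = del_slice S e"
  by (simp add: con_slice_eq_del_slice twist_twist)

lemma pen_slice_twist: "pen_slice (twist S {e}) e = pen_slice S e"
proof -
  have "e \<notin> F \<Longrightarrow> sym_diff F {e} = insert e F" "e \<notin> F \<Longrightarrow> sym_diff (insert e F) {e} = F" for F
    by auto
  then show ?thesis unfolding pen_slice_def by (auto simp: feasible_twist)
qed

lemma slices_loop_complementation: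
  assumes S: "set_system S" and e: "e \<in> ground S"
  shows "del_slice (loop_complementation S {e}) e = del_slice S e"
    and "con_slice (loop_complementation S {e}) e = pen_slice S e"
    and "pen_slice (loop_complementation S {e}) e = con_slice S e"
proof -
  have "insert e F \<in> feasible S \<Longrightarrow> F \<subseteq> ground S" for F
    using set_system_feasible_subset[OF S] by blast
  then show "del_slice (loop_complementation S {e}) e = del_slice S e"
    "con_slice (loop_complementation S {e}) e = pen_slice S e"
    "pen_slice (loop_complementation S {e}) e = con_slice S e"
    unfolding del_slice_def con_slice_def pen_slice_def
    using set_system_feasible_subset[OF S] e
    by (auto simp: feasible_loop_complementation_singleton S)
qed

text \<open>The twist swaps the deletion and contraction slices, loop complementation the
  contraction and Penrose slices; each fixes the third.\<close>

lemma slices_dual_same: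
  assumes "set_system S" "e \<in> ground S"
  shows "slices (twist S {e}) e = slices S e"
    and "slices (loop_complementation S {e}) e = slices S e"
  using assms
  by (auto simp: slices_def del_slice_twist con_slice_twist pen_slice_twist
      slices_loop_complementation)

text \<open>Operations at distinct elements act on different tensor factors, hence commute with each
  slice separately.\<close>

lemma slices_twist_other:
  assumes "x \<noteq> e"
  shows "slices (twist S {x}) e = (\<lambda>M. twist M {x}) ` slices S e"
proof -
  have e: "e \<in> sym_diff F {x} \<longleftrightarrow> e \<in> F" for F using assms by blast
  have ins: "insert e (sym_diff F {x}) = sym_diff (insert e F) {x}" for F using assms by auto
  note defs = del_slice_def con_slice_def pen_slice_def fst_conv snd_conv mem_Collect_eq
    ground_twist feasible_twist e ins
  have "del_slice (twist S {x}) e = twist (del_slice S e) {x}"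
    "con_slice (twist S {x}) e = twist (con_slice S e) {x}"
    "pen_slice (twist S {x}) e = twist (pen_slice S e) {x}"
    by (rule set_system_eqI; simp only: defs)+
  then show ?thesis by (simp add: slices_def)
qed

lemma slices_loop_complementation_other:
  assumes S: "set_system S" and "x \<noteq> e" "e \<in> ground S"
  shows "slices (loop_complementation S {x}) e = (\<lambda>M. loop_complementation M {x}) ` slices S e"
proof -
  have sub: "insert e F \<in> feasible S \<Longrightarrow> F \<subseteq> ground S" for F
    using set_system_feasible_subset[OF S] by blast
  have M: "set_system (del_slice S e)" "set_system (con_slice S e)" "set_system (pen_slice S e)"
    by (rule slices_set_system[OF S, of _ e]; simp add: slices_def)+
  have ins: "insert e F - {x} = insert e (F - {x})" for F using assms by auto
  note simps = feasible_loop_complementation_singleton S M ins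
  have "del_slice (loop_complementation S {x}) e = loop_complementation (del_slice S e) {x}"
    "con_slice (loop_complementation S {x}) e = loop_complementation (con_slice S e) {x}"
    "pen_slice (loop_complementation S {x}) e = loop_complementation (pen_slice S e) {x}"
    using assms sub set_system_feasible_subset[OF S]
    by (auto intro!: set_system_eqI simp: simps)
      (auto simp: del_slice_def con_slice_def pen_slice_def simps)
  then show ?thesis by (simp add: slices_def)
qed

text \<open>A step at \<open>e\<close> permutes the slices, so \<open>M\<close> itself survives; a
  step at another element restricts to \<open>M\<close>.\<close>

lemma slices_dual_step:
  assumes S: "set_system S" and "dual_step S T" and e: "e \<in> ground S" and M: "M \<in> slices S e"
  shows "\<exists>N \<in> slices T e. dual_step\<^sup>*\<^sup>* M N"
  using assms(2)
proof cases
  case (twist x)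
  show ?thesis
  proof (cases "x = e")
    case True
    then show ?thesis using twist M e by (auto simp: slices_dual_same S)
  next
    case False
    then have "dual_step M (twist M {x})"
      using twist M by (auto simp: ground_slices intro: dual_step.twist)
    then show ?thesis using twist False M by (auto simp: slices_twist_other)
  qed
next
  case (loop_complementation x)
  show ?thesis
  proof (cases "x = e")
    case True
    then show ?thesis using loop_complementation M e by (auto simp: slices_dual_same S)
  next
    case False
    then have "dual_step M (loop_complementation M {x})"
      using loop_complementation M by (auto simp: ground_slices intro: dual_step.loop_complementation)
    then show ?thesis
      using loop_complementation False M e by (auto simp: slices_loop_complementation_other S)
  qed
qed

lemma slices_dual_steps:
  assumes S: "set_system S" and "dual_step\<^sup>*\<^sup>* S T" and e: "e \<in> ground S" and M: "M \<in> slices S e"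
  shows "\<exists>N \<in> slices T e. dual_step\<^sup>*\<^sup>* M N"
  using assms(2)
proof (induction rule: rtranclp_induct)
  case base
  then show ?case using M by blast
next
  case (step T U)
  then obtain N where N: "N \<in> slices T e" "dual_step\<^sup>*\<^sup>* M N" by blast
  have "set_system T" "e \<in> ground T"
    using step(1) S e by (auto simp: dual_steps_set_system dual_steps_ground)
  then obtain K where "K \<in> slices U e" "dual_step\<^sup>*\<^sup>* N K"
    using slices_dual_step[OF _ step(2) _ N(1)] by blast
  then show ?case using N(2) by (meson rtranclp_trans)
qed

text \<open>Lifting of duals: a step inside a slice happens at some \<open>x \<noteq> e\<close>, so
  it can be performed on the whole system.\<close>

lemma steps_slices:
  assumes S: "set_system S" and e: "e \<in> ground S"
    and "dual_step\<^sup>*\<^sup>* M N" and M: "M \<in> slices S e"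
  shows "\<exists>T. dual_step\<^sup>*\<^sup>* S T \<and> N \<in> slices T e"
  using assms(3)
proof (induction rule: rtranclp_induct)
  case base
  then show ?case using M by blast
next
  case (step N K)
  then obtain T where T: "dual_step\<^sup>*\<^sup>* S T" "N \<in> slices T e" by blast
  have T': "set_system T" "e \<in> ground T"
    using T(1) S e by (auto simp: dual_steps_set_system dual_steps_ground)
  from step(2) obtain U where "dual_step T U" "K \<in> slices U e"
  proof cases
    case (twist x)
    then have "x \<in> ground T" "x \<noteq> e" using T(2) by (auto simp: ground_slices)
    then show ?thesis using twist(1) T(2) that[OF dual_step.twist[of x T]]
      by (simp add: slices_twist_other)
  next
    case (loop_complementation x)
    then have "x \<in> ground T" "x \<noteq> e" using T(2) by (auto simp: ground_slices)
    then show ?thesis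
      using loop_complementation(1) T(2) T' that[OF dual_step.loop_complementation[of x T]]
      by (simp add: slices_loop_complementation_other)
  qed
  then show ?case using T(1) by (meson rtranclp.rtrancl_into_rtrancl)
qed

text \<open>Contraction is deletion after the twist at \<open>e\<close>, Penrose contraction is
  deletion after loop complementation and then twist. Thus the exchange axiom has to be checked for
  deletions only.\<close>

lemma slices_eq_del_slice:
  assumes S: "set_system S" and e: "e \<in> ground S" and M: "M \<in> slices S e"
  shows "\<exists>T. dual_step\<^sup>*\<^sup>* S T \<and> M = del_slice T e"
proof -
  let ?L = "loop_complementation S {e}"
  have L: "dual_step S ?L" using e by (rule dual_step.loop_complementation)
  have "dual_step S (twist S {e})" using e by (rule dual_step.twist)
  moreover have "dual_step ?L (twist ?L {e})" using e by (auto intro: dual_step.twist)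
  with L have "dual_step\<^sup>*\<^sup>* S (twist ?L {e})" by (meson r_into_rtranclp rtranclp.rtrancl_into_rtrancl)
  moreover have "con_slice S e = del_slice (twist S {e}) e" "pen_slice S e = del_slice (twist ?L {e}) e"
    by (simp_all add: slices_loop_complementation S e del_slice_twist)
  ultimately show ?thesis using M unfolding slices_def by blast
qed

section \<open>Inheritance of vf-safety and the link with \<open>3\<close>-minors\<close>

lemma delta_matroid_del_slice:
  assumes T: "delta_matroid T" and "proper (del_slice T e)"
  shows "delta_matroid (del_slice T e)"
proof -
  have "set_system (del_slice T e)"
    using T slices_set_system[of T "del_slice T e" e] by (simp add: delta_matroid_def slices_def)
  moreover have "\<exists>v \<in> sym_diff X Y. sym_diff X {u, v} \<in> feasible (del_slice T e)"
    if X: "X \<in> feasible (del_slice T e)" and Y: "Y \<in> feasible (del_slice T e)"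
      and u: "u \<in> sym_diff X Y" for X Y u
  proof -
    have XY: "X \<in> feasible T" "Y \<in> feasible T" "e \<notin> X" "e \<notin> Y"
      using X Y by (auto simp: del_slice_def)
    then obtain v where v: "v \<in> sym_diff X Y" "sym_diff X {u, v} \<in> feasible T"
      using T u unfolding delta_matroid_def by blast
    moreover have "e \<notin> sym_diff X {u, v}" using XY u v(1) by blast
    ultimately show ?thesis by (auto simp: del_slice_def)
  qed
  ultimately show ?thesis using assms(2) unfolding delta_matroid_def by blast
qed

text \<open>A twisted dual of the slice lifts to a slice of a twisted dual of \<open>S\<close>,
  which is the deletion slice of a further twisted dual.\<close>

lemma vf_safe_minor_step:
  assumes S: "set_system S" and "vf_safe S" "minor_step S M"
  shows "vf_safe M"
  unfolding vf_safe_def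
proof (intro allI impI)
  fix N assume N: "dual_step\<^sup>*\<^sup>* M N"
  obtain e where e: "e \<in> ground S" "M \<in> slices S e" "proper M"
    using assms(3) by (auto simp: minor_step_def)
  obtain T where T: "dual_step\<^sup>*\<^sup>* S T" "N \<in> slices T e"
    using steps_slices[OF S e(1) N e(2)] by blast
  then obtain U where U: "dual_step\<^sup>*\<^sup>* T U" "N = del_slice U e"
    using slices_eq_del_slice[of T e N] S e(1) by (auto simp: dual_steps_set_system dual_steps_ground)
  have "delta_matroid U" using assms(2) T(1) U(1) unfolding vf_safe_def by (meson rtranclp_trans)
  moreover have "proper N" using dual_steps_proper[OF slices_set_system[OF S e(2)] N e(3)] .
  ultimately show "delta_matroid N" using delta_matroid_del_slice[of U e] U(2) by simp
qed

text \<open>The indicator functions of the three slices sum to zero over \<open>GF(2)\<close>. Hence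
  if one slice is improper the other two agree, and they are proper because \<open>S\<close> is. The
  replacement made at a loop or coloop therefore only repeats a proper slice.\<close>

lemma minors_eq_proper_slices:
  assumes S: "set_system S" and "proper S" and e: "e \<in> ground S"
  shows "{deletion S e, contraction S e, penrose_contraction S e} = {M \<in> slices S e. proper M}"
proof -
  have con: "{F - {e} | F. F \<in> feasible T \<and> e \<in> F} = {F. e \<notin> F \<and> insert e F \<in> feasible T}"
    for T :: "'a set_system"
  proof -
    have "G = F - {e} \<and> e \<in> F \<longleftrightarrow> e \<notin> G \<and> F = insert e G" for F G by blast
    then have "(\<exists>F. G = F - {e} \<and> F \<in> feasible T \<and> e \<in> F) \<longleftrightarrow>
        e \<notin> G \<and> insert e G \<in> feasible T" for G
      by metis
    then show ?thesis by simp
  qed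
  have loop: "is_loop T e \<longleftrightarrow> \<not> proper (con_slice T e)" if "e \<in> ground T" for T
  proof -
    have "(\<exists>F. e \<notin> F \<and> insert e F \<in> feasible T) \<longleftrightarrow> (\<exists>F \<in> feasible T. e \<in> F)"
      by (metis insertI1 mk_disjoint_insert)
    then show ?thesis using that by (simp add: is_loop_def proper_def con_slice_def)
  qed
  have coloop: "is_coloop S e \<longleftrightarrow> \<not> proper (del_slice S e)"
    using e unfolding is_coloop_def proper_def del_slice_def by auto
  have del: "deletion S e = (if proper (del_slice S e) then del_slice S e else con_slice S e)"
    unfolding deletion_def con coloop by (auto simp: del_slice_def con_slice_def)
  \<comment> \<open>General in \<open>T\<close>, since the Penrose contraction applies it to the
    loop complementation of \<open>S\<close> at \<open>e\<close>.\<close>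
  have ctr: "contraction T e = (if proper (con_slice T e) then con_slice T e else del_slice T e)"
    if "e \<in> ground T" for T
    unfolding contraction_def con loop[OF that] by (auto simp: del_slice_def con_slice_def)
  have pen: "penrose_contraction S e =
      (if proper (pen_slice S e) then pen_slice S e else del_slice S e)"
    unfolding penrose_contraction_def
    by (simp add: ctr e slices_loop_complementation S)
  have "\<exists>F. e \<notin> F \<and> (F \<in> feasible S \<or> insert e F \<in> feasible S)"
    using assms(2) unfolding proper_def
    by (metis Diff_iff all_not_in_conv insertI1 insert_Diff)
  then have one: "proper (del_slice S e) \<or> proper (con_slice S e)"
    by (auto simp: proper_def del_slice_def con_slice_def)
  have d: "pen_slice S e = con_slice S e" if "\<not> proper (del_slice S e)"
    using that unfolding proper_def del_slice_def con_slice_def pen_slice_def by auto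
  have c: "pen_slice S e = del_slice S e" if "\<not> proper (con_slice S e)"
    using that unfolding proper_def del_slice_def con_slice_def pen_slice_def by auto
  have p: "con_slice S e = del_slice S e" if "\<not> proper (pen_slice S e)"
    using that unfolding proper_def del_slice_def con_slice_def pen_slice_def by auto
  show ?thesis unfolding del pen ctr[OF e] slices_def using one d c p by auto
qed

lemma minor_steps_invariants:
  assumes "minor_step\<^sup>*\<^sup>* S M" "set_system S" "proper S"
  shows "set_system M \<and> proper M"
  using assms by (induction rule: rtranclp_induct) (auto simp: minor_step_def slices_set_system)

lemma three_minor_iff_minor_steps:
  assumes S: "set_system S" "proper S"
  shows "three_minor S M \<longleftrightarrow> minor_step\<^sup>*\<^sup>* S M"
proof
  have step: "minor_step T N"
    if "minor_step\<^sup>*\<^sup>* S T" "e \<in> ground T"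
      "N \<in> {deletion T e, contraction T e, penrose_contraction T e}" for T N e
    using that minors_eq_proper_slices[of T e] minor_steps_invariants[OF that(1) S]
    by (auto simp: minor_step_def)
  assume "three_minor S M"
  then show "minor_step\<^sup>*\<^sup>* S M"
    by (induction rule: three_minor.induct)
      (auto intro: step rtranclp.rtrancl_into_rtrancl)
next
  assume "minor_step\<^sup>*\<^sup>* S M"
  then show "three_minor S M"
  proof (induction rule: rtranclp_induct)
    case base
    show ?case by (rule three_minor.refl)
  next
    case (step T N)
    then obtain e where "e \<in> ground T" "N \<in> {M \<in> slices T e. proper M}"
      by (auto simp: minor_step_def)
    then have "N \<in> {deletion T e, contraction T e, penrose_contraction T e}"
      using minors_eq_proper_slices[of T e] minor_steps_invariants[OF step(1) S] by simp
    then show ?case using step(3) \<open>e \<in> ground T\<close>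
      by (auto intro: three_minor.deletion three_minor.contraction three_minor.penrose_contraction)
  qed
qed

section \<open>Isomorphism\<close>

lemma isomorphic_sym:
  assumes S: "set_system S" and "isomorphic S T"
  shows "isomorphic T S"
proof -
  obtain f where f: "bij_betw f (ground S) (ground T)" "(\<lambda>F. f ` F) ` feasible S = feasible T"
    using assms(2) by (auto simp: isomorphic_def)
  let ?g = "inv_into (ground S) f"
  have "?g ` f ` F = F" if "F \<in> feasible S" for F
    using that set_system_feasible_subset[OF S] f(1) by (auto simp: bij_betw_def image_inv_into_cancel
        intro!: inv_into_image_cancel)
  then have "(\<lambda>F. ?g ` f ` F) ` feasible S = (\<lambda>F. F) ` feasible S" by (rule image_cong[OF HOL.refl])
  moreover have "(\<lambda>F. ?g ` F) ` feasible T = (\<lambda>F. ?g ` f ` F) ` feasible S"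
    unfolding f(2)[symmetric] by (rule image_image)
  ultimately have "(\<lambda>F. ?g ` F) ` feasible T = feasible S" by simp
  then show ?thesis using bij_betw_inv_into[OF f(1)] unfolding isomorphic_def by blast
qed

text \<open>The matching step is the same operation at \<open>f x\<close>, and the bijection
  \<open>f\<close> itself remains an isomorphism.\<close>

lemma isomorphic_dual_step:
  assumes S: "set_system S" and T: "set_system T" and "isomorphic S T" "dual_step S S'"
  shows "\<exists>T'. dual_step T T' \<and> isomorphic S' T'"
proof -
  obtain f where f: "bij_betw f (ground S) (ground T)" "(\<lambda>F. f ` F) ` feasible S = feasible T"
    using assms(3) by (auto simp: isomorphic_def)
  have inj: "inj_on f (ground S)" and img: "f ` ground S = ground T" using f(1) by (auto simp: bij_betw_def)
  have mem: "f ` F \<in> feasible T \<longleftrightarrow> F \<in> feasible S" if "F \<subseteq> ground S" for F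
  proof
    assume "f ` F \<in> feasible T"
    then obtain G where "G \<in> feasible S" "f ` F = f ` G" unfolding f(2)[symmetric] by (rule imageE)
    then show "F \<in> feasible S"
      using inj_on_image_eq_iff[OF inj that] set_system_feasible_subset[OF S] by simp
  next
    assume "F \<in> feasible S"
    then show "f ` F \<in> feasible T" unfolding f(2)[symmetric] by (rule imageI)
  qed
  have iso: "isomorphic S' T'"
    if S': "set_system S'" and T': "set_system T'" and g: "ground S' = ground S" "ground T' = ground T"
      and m: "\<And>F. F \<subseteq> ground S \<Longrightarrow> f ` F \<in> feasible T' \<longleftrightarrow> F \<in> feasible S'" for S' T'
  proof -
    have "(\<lambda>F. f ` F) ` feasible S' = feasible T'"
    proof
      show "(\<lambda>F. f ` F) ` feasible S' \<subseteq> feasible T'"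
        using m set_system_feasible_subset[OF S'] g by auto
      show "feasible T' \<subseteq> (\<lambda>F. f ` F) ` feasible S'"
      proof
        fix G assume G: "G \<in> feasible T'"
        then have "G \<subseteq> f ` ground S" using set_system_feasible_subset[OF T'] g img by auto
        then obtain F where "F \<subseteq> ground S" "G = f ` F" by (auto simp: subset_image_iff)
        then show "G \<in> (\<lambda>F. f ` F) ` feasible S'" using m G by auto
      qed
    qed
    then show ?thesis using f(1) g unfolding isomorphic_def by auto
  qed
  have diff: "f ` (F - {x}) = f ` F - {f x}" if "F \<subseteq> ground S" "x \<in> ground S" for F x
    using inj_on_image_set_diff[OF inj, of F "{x}"] that by auto
  from assms(4) show ?thesis
  proof cases
    case (twist x)
    have x: "f x \<in> ground T" using twist img by blast
    have "isomorphic (twist S {x}) (twist T {f x})"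
    proof (rule iso)
      fix F assume F: "F \<subseteq> ground S"
      have "f ` (sym_diff F {x}) = sym_diff (f ` F) {f x}"
        using F twist inj_on_image_set_diff[OF inj, of "{x}" F] diff[of F x]
        by (auto simp: image_Un)
      then show "f ` F \<in> feasible (twist T {f x}) \<longleftrightarrow> F \<in> feasible (twist S {x})"
        using mem[of "sym_diff F {x}"] F twist by (simp add: feasible_twist Un_subset_iff subset_iff)
    qed (use S T twist x in \<open>auto intro: set_system_twist\<close>)
    then show ?thesis using twist(1) dual_step.twist[OF x] by blast
  next
    case (loop_complementation x)
    have x: "f x \<in> ground T" using loop_complementation img by blast
    have "isomorphic (loop_complementation S {x}) (loop_complementation T {f x})"
    proof (rule iso)
      fix F assume F: "F \<subseteq> ground S"
      have "f ` F \<subseteq> ground T" using F img by blast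
      moreover have "f x \<in> f ` F \<longleftrightarrow> x \<in> F"
        using inj_on_image_mem_iff[OF inj] F loop_complementation by blast
      moreover have "f ` F - {f x} \<in> feasible T \<longleftrightarrow> F - {x} \<in> feasible S"
        using mem[of "F - {x}"] diff[of F x] F loop_complementation by auto
      ultimately show "f ` F \<in> feasible (loop_complementation T {f x}) \<longleftrightarrow>
          F \<in> feasible (loop_complementation S {x})"
        using mem[OF F] F by (simp add: feasible_loop_complementation_singleton S T)
    qed (use S T in \<open>auto intro: set_system_loop_complementation\<close>)
    then show ?thesis using loop_complementation(1) dual_step.loop_complementation[OF x] by blast
  qed
qed

lemma isomorphic_dual_steps:
  assumes S: "set_system S" and T: "set_system T" and "isomorphic S T" "dual_step\<^sup>*\<^sup>* S S'"
  shows "\<exists>T'. dual_step\<^sup>*\<^sup>* T T' \<and> isomorphic S' T'"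
  using assms(4)
proof (induction rule: rtranclp_induct)
  case base
  then show ?case using assms(3) by blast
next
  case (step S1 S2)
  then obtain T1 where T1: "dual_step\<^sup>*\<^sup>* T T1" "isomorphic S1 T1" by blast
  then obtain T2 where "dual_step T1 T2" "isomorphic S2 T2"
    using isomorphic_dual_step[OF dual_steps_set_system[OF step(1) S]
        dual_steps_set_system[OF T1(1) T] T1(2) step(2)] by blast
  then show ?case using T1(1) by (meson rtranclp.rtrancl_into_rtrancl)
qed

section \<open>The excluded minor\<close>

lemma set_system_S3: "set_system S3"
  by (simp add: set_system_def S3_def)

text \<open>Exchange from \<open>{}\<close> towards the three-element feasible set would produce a
  feasible set with one or two elements.\<close>

lemma isomorphic_S3_not_delta_matroid:
  assumes "set_system M" "isomorphic S3 M"
  shows "\<not> delta_matroid M"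
proof
  assume dm: "delta_matroid M"
  obtain f where f: "bij_betw f {1, 2, 3 :: nat} (ground M)" "{{}, f ` {1, 2, 3}} = feasible M"
    using assms(2) by (auto simp: isomorphic_def S3_def)
  define Y where "Y = f ` {1, 2, 3}"
  have Y: "feasible M = {{}, Y}" using f(2) by (simp add: Y_def)
  have "f 1 \<in> sym_diff {} Y" by (simp add: Y_def)
  then obtain v where v: "sym_diff {} {f 1, v} \<in> feasible M"
    using dm Y unfolding delta_matroid_def by blast
  have "sym_diff {} {f 1, v} = {f 1, v}" by blast
  then have "{f 1, v} = f ` {1, 2, 3}"
    using v unfolding Y Y_def[symmetric] by (metis empty_iff insert_iff)
  moreover have "card (f ` {1, 2, 3}) = 3"
    using card_image[OF bij_betw_imp_inj_on[OF f(1)]] by simp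
  ultimately have "card {f 1, v} = 3" by simp
  moreover have "card {f 1, v} \<le> 2" by (simp add: card_insert_if)
  ultimately show False by simp
qed

text \<open>Vf-safety descends to \<open>M\<close>. Undoing along the isomorphism the steps from
  \<open>S3\<close> to \<open>D\<close> gives a twisted dual of \<open>M\<close> that is a copy of
  \<open>S3\<close>.\<close>

lemma vf_safe_no_S3_minor:
  assumes S: "set_system S" "proper S" and "vf_safe S"
    and M: "minor_step\<^sup>*\<^sup>* S M" and D: "dual_step\<^sup>*\<^sup>* S3 D" and "isomorphic M D"
  shows False
proof -
  have M': "set_system M" using minor_steps_invariants[OF M S] by blast
  have "vf_safe M" using M
  proof (induction rule: rtranclp_induct)
    case (step T N)
    then show ?case using vf_safe_minor_step minor_steps_invariants[OF step(1) S] by blast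
  qed (fact assms(3))
  have D': "set_system D" using dual_steps_set_system[OF D set_system_S3] .
  obtain N where N: "dual_step\<^sup>*\<^sup>* M N" "isomorphic S3 N"
    using isomorphic_dual_steps[OF D' M' isomorphic_sym[OF M' assms(6)]
        dual_steps_sym[OF set_system_S3 D]] by blast
  then have "set_system N" using dual_steps_set_system M' by blast
  then have "\<not> delta_matroid N" using isomorphic_S3_not_delta_matroid N(2) by blast
  then show False using \<open>vf_safe M\<close> N(1) unfolding vf_safe_def by blast
qed

text \<open>
  A failure of the exchange axiom for \<open>X\<close>, \<open>X'\<close> and \<open>u\<close>, moved to \<open>X = {}\<close> and \<open>Y = X \<triangle> X'\<close> by the
  twist with \<open>X\<close>.
\<close>

definition obstructed :: "'a set_system \<Rightarrow> 'a \<Rightarrow> 'a set \<Rightarrow> bool" where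
  "obstructed T u Y \<longleftrightarrow>
     {} \<in> feasible T \<and> Y \<in> feasible T \<and> u \<in> Y \<and> (\<forall>v \<in> Y. {u, v} \<notin> feasible T)"

section \<open>From failures of exchange to \<open>S3\<close>\<close>

lemma obstructed_not_vf_safe: "obstructed T u Y \<Longrightarrow> \<not> vf_safe T"
proof
  assume T: "obstructed T u Y" and "vf_safe T"
  then have "delta_matroid T" unfolding vf_safe_def by blast
  then have "\<exists>v \<in> sym_diff {} Y. sym_diff {} {u, v} \<in> feasible T"
    using T unfolding delta_matroid_def obstructed_def by (metis Diff_empty Un_iff)
  then show False using T by (auto simp: obstructed_def)
qed

lemma not_vf_safe_obstructed:
  assumes S: "set_system S" "proper S" and "\<not> vf_safe S"
  obtains T u Y where "dual_step\<^sup>*\<^sup>* S T" "obstructed T u Y"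
proof -
  obtain T where T: "dual_step\<^sup>*\<^sup>* S T" "\<not> delta_matroid T"
    using assms(3) unfolding vf_safe_def by blast
  have T': "set_system T" "proper T"
    using T(1) S dual_steps_set_system dual_steps_proper by blast+
  then obtain X Y u where XY: "X \<in> feasible T" "Y \<in> feasible T" "u \<in> sym_diff X Y"
    "\<forall>v \<in> sym_diff X Y. sym_diff X {u, v} \<notin> feasible T"
    using T(2) unfolding delta_matroid_def by blast
  have "X \<subseteq> ground T" using XY(1) T'(1) by (rule set_system_feasible_subset[rotated])
  then have "dual_step\<^sup>*\<^sup>* T (twist T X)"
    using dual_steps_twist T'(1) by (meson finite_subset set_system_def)
  then have "dual_step\<^sup>*\<^sup>* S (twist T X)" using T(1) by (meson rtranclp_trans)
  moreover have "sym_diff (sym_diff X Y) X = Y" by blast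
  then have "obstructed (twist T X) u (sym_diff X Y)"
    using XY unfolding obstructed_def feasible_twist by (simp add: Un_commute)
  ultimately show thesis by (rule that)
qed

text \<open>The sets to be removed are \<open>{a}\<close>, \<open>{b}\<close> and
  \<open>{a, b}\<close>, in this order: removing a singleton may create \<open>{a, b}\<close>, while
  the last operation affects \<open>{a, b}\<close> alone.\<close>

lemma obstructed_card_3:
  assumes T: "set_system T" and obs: "obstructed T u (ground T)" and card: "card (ground T) = 3"
    and only: "\<And>F. F \<in> feasible T \<Longrightarrow> u \<in> F \<Longrightarrow> F = ground T"
  shows "\<exists>U. dual_step\<^sup>*\<^sup>* T U \<and> isomorphic U S3"
proof -
  have "card (ground T - {u}) = 2"
    using card obs by (simp add: obstructed_def set_system_feasible_subset T card_Diff_singleton_if)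
  then obtain a b where "ground T - {u} = {a, b}" "a \<noteq> b" by (meson card_2_iff)
  then have ab: "ground T = {u, a, b}" "a \<noteq> b" "a \<noteq> u" "b \<noteq> u"
    using obs by (auto simp: obstructed_def)
  \<comment> \<open>The invariant of the removal steps.\<close>
  define Q where "Q U \<longleftrightarrow> dual_step\<^sup>*\<^sup>* T U \<and> {} \<in> feasible U \<and> {u, a, b} \<in> feasible U \<and>
    (\<forall>F \<in> feasible U. u \<in> F \<longrightarrow> F = {u, a, b})" for U
  have QD: "set_system U" "ground U = {u, a, b}" if "Q U" for U
    using that ab(1) dual_steps_set_system[OF _ T, of U] dual_steps_ground[of T U]
    by (simp_all add: Q_def)
  have QE: "F = {u, a, b}" if "Q U" "F \<in> feasible U" "u \<in> F" for F U
    using that by (simp add: Q_def)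
  have Q0: "Q T" using obs only unfolding Q_def obstructed_def ab(1) by simp
  \<comment> \<open>A set containing \<open>u\<close> could change only through its subset without
    \<open>x\<close>. That subset contains \<open>u\<close> but is not the full set, so it is
    infeasible.\<close>
  have lc: "Q (loop_complementation U {x})" if U: "Q U" and x: "x \<in> {a, b}" for U x
  proof -
    have "dual_step\<^sup>*\<^sup>* T (loop_complementation U {x})"
      using U x QD[OF U] dual_step.loop_complementation[of x U]
      by (auto simp: Q_def intro: rtranclp.rtrancl_into_rtrancl)
    moreover have "{u, a, b} - {x} \<notin> feasible U"
    proof
      assume "{u, a, b} - {x} \<in> feasible U"
      moreover have "u \<in> {u, a, b} - {x}" using x ab by auto
      ultimately have "{u, a, b} - {x} = {u, a, b}" by (rule QE[OF U])
      then show False using x by blast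
    qed
    moreover have "F = {u, a, b}"
      if "F \<in> feasible (loop_complementation U {x})" "u \<in> F" for F
    proof (rule ccontr)
      assume "F \<noteq> {u, a, b}"
      then have "F \<notin> feasible U" using U that(2) by (auto simp: Q_def)
      then have "F - {x} \<in> feasible U"
        using that by (simp add: feasible_loop_complementation_singleton QD[OF U])
      moreover have "u \<in> F - {x}" using that x ab by auto
      ultimately have "F - {x} = {u, a, b}" by (rule QE[OF U])
      then show False using x by blast
    qed
    ultimately show ?thesis
      using U by (auto simp: Q_def feasible_loop_complementation_singleton QD[OF U])
  qed
  obtain U where U: "Q U" "{a} \<notin> feasible U"
  proof (cases "{a} \<in> feasible T")
    case True
    \<comment> \<open>Since \<open>{}\<close> is feasible, complementation at \<open>a\<close>
      toggles \<open>{a}\<close>.\<close>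
    then have "{a} \<notin> feasible (loop_complementation T {a})"
      using Q0 by (auto simp: Q_def feasible_loop_complementation_singleton T)
    then show ?thesis using lc[OF Q0, of a] that by auto
  qed (use Q0 that in auto)
  obtain V where V: "Q V" "{a} \<notin> feasible V" "{b} \<notin> feasible V"
  proof (cases "{b} \<in> feasible U")
    case True
    \<comment> \<open>Complementation at \<open>b\<close> toggles \<open>{b}\<close> and does not
      touch \<open>{a}\<close>, which omits \<open>b\<close>.\<close>
    then have "{b} \<notin> feasible (loop_complementation U {b})" "{a} \<notin> feasible (loop_complementation U {b})"
      using U ab by (auto simp: Q_def feasible_loop_complementation_singleton QD[OF U(1)])
    then show ?thesis using lc[OF U(1), of b] that by auto
  qed (use U that in auto)
  obtain W where W: "Q W" "{a} \<notin> feasible W" "{b} \<notin> feasible W" "{a, b} \<notin> feasible W"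
  proof (cases "{a, b} \<in> feasible V")
    case True
    text \<open>Conjugating \<open>+u\<close> by the twist at \<open>u\<close> adds the contraction to the deletion.\<close>
    define V1 where "V1 = twist V {u}"
    define V2 where "V2 = loop_complementation V1 {u}"
    define W where "W = twist V2 {u}"
    have V': "set_system V" "ground V = {u, a, b}" using QD V(1) by auto
    have V1: "set_system V1" using V' by (simp add: V1_def set_system_twist)
    have steps: "dual_step V V1" "dual_step V1 V2" "dual_step V2 W"
      unfolding W_def V2_def V1_def using V'
      by (auto intro!: dual_step.twist dual_step.loop_complementation)
    have "dual_step\<^sup>*\<^sup>* T V" using V(1) by (simp add: Q_def)
    then have W1: "dual_step\<^sup>*\<^sup>* T W" using steps by (meson rtranclp.rtrancl_into_rtrancl)
    have feas: "F \<in> feasible W \<longleftrightarrow>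
        (F \<in> feasible V) \<noteq> (u \<notin> F \<and> insert u F \<in> feasible V)" if "F \<subseteq> {u, a, b}" for F
    proof -
      have "sym_diff (sym_diff F {u}) {u} = F" by blast
      moreover have "u \<in> sym_diff F {u} \<longleftrightarrow> u \<notin> F" by blast
      moreover have "sym_diff (sym_diff F {u} - {u}) {u} = insert u F" by blast
      moreover have "sym_diff F {u} \<subseteq> {u, a, b}" using that by blast
      ultimately show ?thesis
        unfolding W_def V2_def using V'
        by (simp add: feasible_twist feasible_loop_complementation_singleton V1 V1_def[symmetric])
          (simp add: V1_def feasible_twist)
    qed
    \<comment> \<open>Only the full set is feasible with \<open>u\<close>, so among the sets without
      \<open>u\<close> only \<open>{a, b}\<close> is toggled.\<close>
    have F1: "insert u F \<in> feasible V \<longleftrightarrow> insert u F = {u, a, b}" for F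
      using V(1) by (auto simp: Q_def)
    have "{u} \<noteq> {u, a, b}" "{u, a} \<noteq> {u, a, b}" "{u, b} \<noteq> {u, a, b}" using ab by auto
    then have W2: "{} \<in> feasible W" "{a} \<notin> feasible W" "{b} \<notin> feasible W"
      "{a, b} \<notin> feasible W" "{u, a, b} \<in> feasible W"
      using V True ab by (auto simp: feas F1 Q_def)
    have sW: "set_system W" "ground W = {u, a, b}"
      using W1 T ab(1) by (simp_all add: dual_steps_set_system dual_steps_ground)
    have W3: "F = {u, a, b}" if "F \<in> feasible W" "u \<in> F" for F
    proof (rule QE[OF V(1) _ that(2)])
      have "F \<subseteq> {u, a, b}" using set_system_feasible_subset[OF sW(1) that(1)] sW(2) by simp
      then show "F \<in> feasible V" using feas that by simp
    qed
    have "Q W" unfolding Q_def using W1 W2(1,5) W3 by (intro conjI ballI impI)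
    then show ?thesis using W2(2-4) by (rule that)
  qed (use V that in auto)
  have "feasible W = {{}, {u, a, b}}"
  proof
    show "feasible W \<subseteq> {{}, {u, a, b}}"
    proof
      fix F assume F: "F \<in> feasible W"
      show "F \<in> {{}, {u, a, b}}"
      proof (cases "u \<in> F")
        case True
        then show ?thesis using F W(1) by (auto simp: Q_def)
      next
        case False
        have "F \<subseteq> {u, a, b}" using F QD[OF W(1)] set_system_feasible_subset by blast
        then have "F \<in> Pow {a, b}" using False by blast
        then show ?thesis using F W by (auto simp: Pow_insert insert_commute)
      qed
    qed
  qed (use W in \<open>auto simp: Q_def\<close>)
  \<comment> \<open>On the ground set the default value 3 is taken only at \<open>b\<close>.\<close>
  moreover define f :: "'a \<Rightarrow> nat" where "f x = (if x = u then 1 else if x = a then 2 else 3)" for x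
  ultimately have "(\<lambda>F. f ` F) ` feasible W = feasible S3"
    using ab by (auto simp: S3_def)
  moreover have "bij_betw f (ground W) (ground S3)"
    using ab QD(2)[OF W(1)] by (auto simp: bij_betw_def inj_on_def S3_def f_def)
  ultimately have "isomorphic W S3" unfolding isomorphic_def by blast
  moreover have "dual_step\<^sup>*\<^sup>* T W" using W(1) unfolding Q_def by (rule conjunct1)
  ultimately show ?thesis by blast
qed

text \<open>In both slices used, \<open>ground T - {e}\<close> is feasible because
  \<open>ground T\<close> is feasible and \<open>ground T - {e}\<close>, which contains
  \<open>u\<close>, is not. The sets \<open>{u, v}\<close> stay infeasible, and the choice of slice
  makes \<open>{}\<close> feasible.\<close>

lemma obstructed_card_ge_4:
  assumes T: "set_system T" and obs: "obstructed T u (ground T)" and card: "card (ground T) \<ge> 4"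
    and only: "\<And>F. F \<in> feasible T \<Longrightarrow> u \<in> F \<Longrightarrow> F = ground T"
  shows "\<exists>e \<in> ground T. \<exists>M \<in> slices T e. obstructed M u (ground T - {e})"
proof -
  have "\<not> ground T \<subseteq> {u}" using card_mono[of "{u}" "ground T"] card by auto
  then obtain e where e: "e \<in> ground T" "e \<noteq> u" by blast
  \<comment> \<open>This is where four elements are needed: \<open>{u, v, e}\<close> must differ
    from the ground set.\<close>
  have small: "F \<notin> feasible T" if "u \<in> F" "F \<subseteq> {u, v, w}" for F v w
  proof
    assume "F \<in> feasible T"
    then have "ground T \<subseteq> {u, v, w}" using only that by blast
    then have "card (ground T) \<le> card {u, v, w}" by (simp add: card_mono)
    also have "\<dots> \<le> 3" by (simp add: card_insert_if)
    finally show False using card by simp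
  qed
  have top: "insert e (ground T - {e}) = ground T" "ground T - {e} \<notin> feasible T"
    using e only[of "ground T - {e}"] obs by (auto simp: obstructed_def)
  have not: "{u, v} \<notin> feasible T" "insert e {u, v} \<notin> feasible T" for v
    using small[of "{u, v}" v v] small[of "insert e {u, v}" v e] by auto
  have obs': "{} \<in> feasible T" "ground T \<in> feasible T" "u \<in> ground T"
    using obs by (auto simp: obstructed_def)
  show ?thesis
  proof (cases "{e} \<in> feasible T")
    case True
    then have "obstructed (con_slice T e) u (ground T - {e})"
      using e obs' top not by (simp add: obstructed_def con_slice_def)
    then show ?thesis using e by (auto simp: slices_def)
  next
    case False
    then have "obstructed (pen_slice T e) u (ground T - {e})"
      using e obs' top not by (simp add: obstructed_def pen_slice_def)
    then show ?thesis using e by (auto simp: slices_def)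
  qed
qed

text \<open>Induction on the size of the ground set: either some slice of a suitable dual
  \<open>T\<close> is obstructed, or \<open>T\<close> is so restricted that it has three
  elements.\<close>

lemma not_vf_safe_S3_minor:
  assumes "set_system S" "proper S" "\<not> vf_safe S"
  shows "\<exists>M D. minor_step\<^sup>*\<^sup>* S M \<and> dual_step\<^sup>*\<^sup>* S3 D \<and> isomorphic M D"
  using assms
proof (induction "card (ground S)" arbitrary: S rule: less_induct)
  case less
  note S = less.prems(1,2)
  obtain T u Y where T: "dual_step\<^sup>*\<^sup>* S T" "obstructed T u Y"
    using not_vf_safe_obstructed[OF less.prems] by blast
  have sT: "set_system T" "ground T = ground S" and ST: "dual_step\<^sup>*\<^sup>* T S"
    using T(1) S dual_steps_set_system dual_steps_ground dual_steps_sym by blast+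
  show ?case
  proof (cases "\<exists>e \<in> ground T. \<exists>M \<in> slices T e. \<exists>Z. obstructed M u Z")
    case True
    then obtain e M Z where M: "e \<in> ground T" "M \<in> slices T e" "obstructed M u Z" by blast
    \<comment> \<open>The obstruction lives in a slice of \<open>T\<close>; running the steps back
      to \<open>S\<close> turns it into a slice of \<open>S\<close>, dual to \<open>M\<close> and
      hence not vf-safe.\<close>
    obtain N where N: "N \<in> slices S e" "dual_step\<^sup>*\<^sup>* M N"
      using slices_dual_steps[OF sT(1) ST M(1,2)] by blast
    have sM: "set_system M" using slices_set_system[OF sT(1) M(2)] .
    have "proper M" using M(3) by (auto simp: proper_def obstructed_def)
    then have N': "set_system N" "proper N"
      using dual_steps_proper[OF sM N(2)] dual_steps_set_system[OF N(2) sM] by auto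
    have "\<not> vf_safe N"
      using obstructed_not_vf_safe[OF M(3)] vf_safe_dual_steps dual_steps_sym[OF sM N(2)] by blast
    moreover have "card (ground N) < card (ground S)"
      using ground_slices[OF N(1)] M(1) sT S(1)
      by (metis card_Diff1_less set_system_def)
    ultimately obtain K D where "minor_step\<^sup>*\<^sup>* N K" "dual_step\<^sup>*\<^sup>* S3 D" "isomorphic K D"
      using less.hyps N' by blast
    moreover have "minor_step S N" using N(1) N'(2) M(1) sT(2) by (auto simp: minor_step_def)
    ultimately show ?thesis by (meson converse_rtranclp_into_rtranclp)
  next
    case False
    \<comment> \<open>An element outside \<open>F\<close> could be deleted, leaving an obstructed
      slice.\<close>
    have del: "F = ground T" if F: "F \<in> feasible T" "u \<in> F" "\<forall>v \<in> F. {u, v} \<notin> feasible T" for F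
    proof (rule ccontr)
      assume "F \<noteq> ground T"
      then obtain e where e: "e \<in> ground T" "e \<notin> F"
        using set_system_feasible_subset[OF sT(1) F(1)] by blast
      have "obstructed (del_slice T e) u F"
        using F T(2) e by (auto simp: obstructed_def del_slice_def)
      then show False using False e(1) by (auto simp: slices_def)
    qed
    have Y: "Y = ground T" using del T(2) by (auto simp: obstructed_def)
    \<comment> \<open>As \<open>Y\<close> is the whole ground set, the obstruction already forbids
      every pair \<open>{u, v}\<close>, so \<open>del\<close> applies to any feasible set containing
      \<open>u\<close>.\<close>
    have only: "F = ground T" if "F \<in> feasible T" "u \<in> F" for F
    proof (rule del[OF that])
      show "\<forall>v \<in> F. {u, v} \<notin> feasible T"
        using T(2) Y set_system_feasible_subset[OF sT(1) that(1)] by (auto simp: obstructed_def)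
    qed
    have obs: "obstructed T u (ground T)" using T(2) Y by simp
    have fin: "finite (ground T)" using sT(1) by (simp add: set_system_def)
    have "\<not> card (ground T) \<ge> 4"
      using obstructed_card_ge_4[OF sT(1) obs _ only] False by blast
    \<comment> \<open>With at most two elements, \<open>ground T\<close> itself would be one of the
      forbidden sets \<open>{u, w}\<close>, possibly with \<open>w = u\<close>.\<close>
    moreover have "\<not> card (ground T) \<le> 2"
    proof
      assume le: "card (ground T) \<le> 2"
      have u: "u \<in> ground T" using obs by (simp add: obstructed_def)
      then have "card (ground T - {u}) \<le> 1" using le fin by simp
      then obtain v where "ground T - {u} \<subseteq> {v}"
        using fin by (metis card_le_Suc0_iff_eq One_nat_def finite_Diff insertI1 subsetI ex_in_conv
            empty_subsetI)
      then have "\<exists>w \<in> ground T. {u, w} = ground T" using u by (cases "v \<in> ground T") auto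
      then show False using obs by (auto simp: obstructed_def)
    qed
    ultimately have "card (ground T) = 3" by linarith
    then obtain U where U: "dual_step\<^sup>*\<^sup>* T U" "isomorphic U S3"
      using obstructed_card_3[OF sT(1) obs _ only] by blast
    \<comment> \<open>The steps from \<open>U\<close> back to \<open>S\<close>, transported to
      \<open>S3\<close>, show that \<open>S\<close> itself is a copy of a dual of \<open>S3\<close>;
      the minor is \<open>S\<close>.\<close>
    have "dual_step\<^sup>*\<^sup>* U S" using dual_steps_sym[OF sT(1) U(1)] ST by (meson rtranclp_trans)
    then obtain D where "dual_step\<^sup>*\<^sup>* S3 D" "isomorphic S D"
      using isomorphic_dual_steps[OF dual_steps_set_system[OF U(1) sT(1)] set_system_S3 U(2)] by blast
    then show ?thesis by blast
  qed
qed

theorem theorem4p4: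
  fixes S :: "'a set_system"
  assumes "set_system S" and "proper S"
  shows "vf_safe_delta_matroid S \<longleftrightarrow>
    \<not> (\<exists>M D. three_minor S M \<and> twisted_dual S3 D \<and> isomorphic M D)"
  unfolding vf_safe_delta_matroid_iff[OF assms(1)] three_minor_iff_minor_steps[OF assms]
    twisted_dual_iff_dual_steps[OF set_system_S3]
  using vf_safe_no_S3_minor[OF assms] not_vf_safe_S3_minor[OF assms] by blast

end
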